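(* There exist positive constants $c_1$ and $c_2$ such that for all integers $a\geq 2$ and $q\geq 4a^2\log a$, \[ 2q+c_1a\sqrt{q\log a}\leq \chi_{sc}(K_{a,q})\leq 2q+c_2a\sqrt{q\log a}. \]
   Context: $K_{a,q}$ is the complete bipartite graph with parts of sizes $a$ and $q$. For a graph $G=(V,E)$ and $f:V\to\mathbb{N}$, an $f$-assignment is an assignment of color lists $L(v)$ with $|L(v)|=f(v)$; $G$ is $f$-choosable if for every $f$-assignment $L$ there is a proper coloring $c$ with $c(v)\in L(v)$ for all $v$. The sum choice number $\chi_{sc}(G)$ is the minimum of $\sum_{v\in V}f(v)$ over all $f$ such that $G$ is $f$-choosable. *)

theory Defs
  imports Complex_Main "Graph_Theory.Graph_Theory"
begin

text \<open>
  Undirected graphs are the symmetric digraphs of the library: every undirected edge is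
  represented by its two orientations.
\<close>

text \<open>
  Colors are natural numbers; a finite graph never needs more than countably many colors. The
  explicit finiteness condition is needed because \<^const>\<open>card\<close> is \<open>0\<close> on infinite sets.
\<close>

definition list_assignment ::
  "('a, 'b) pre_digraph \<Rightarrow> ('a \<Rightarrow> nat) \<Rightarrow> ('a \<Rightarrow> nat set) \<Rightarrow> bool" where
  "list_assignment G f L \<longleftrightarrow> (\<forall>v \<in> verts G. finite (L v) \<and> card (L v) = f v)"

definition proper_coloring :: "('a, 'b) pre_digraph \<Rightarrow> ('a \<Rightarrow> nat) \<Rightarrow> bool" where
  "proper_coloring G c \<longleftrightarrow> (\<forall>e \<in> arcs G. c (tail G e) \<noteq> c (head G e))"

definition choosable :: "('a, 'b) pre_digraph \<Rightarrow> ('a \<Rightarrow> nat) \<Rightarrow> bool" where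
  "choosable G f \<longleftrightarrow>
     (\<forall>L. list_assignment G f L \<longrightarrow>
        (\<exists>c. proper_coloring G c \<and> (\<forall>v \<in> verts G. c v \<in> L v)))"

definition sum_choice_number :: "('a, 'b) pre_digraph \<Rightarrow> nat" where
  "sum_choice_number G = (LEAST n. \<exists>f. choosable G f \<and> n = (\<Sum>v \<in> verts G. f v))"

definition complete_bipartite :: "nat \<Rightarrow> nat \<Rightarrow> (nat + nat) pair_pre_digraph" where
  "complete_bipartite a q =
     (let A = Inl ` {..<a}; B = Inr ` {..<q}
      in \<lparr> pverts = A \<union> B, parcs = A \<times> B \<union> B \<times> A \<rparr>)"

lemma complete_bipartite_digraph_complete_bipartite:
  "complete_bipartite_digraph a q (with_proj (complete_bipartite a q))"
  unfolding complete_bipartite_digraph_pair_def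
proof (intro conjI exI)
  show "finite (pverts (complete_bipartite a q))"
    by (simp add: complete_bipartite_def Let_def)
  show "pverts (complete_bipartite a q) = Inl ` {..<a} \<union> Inr ` {..<q}"
    by (simp add: complete_bipartite_def Let_def)
  show "parcs (complete_bipartite a q) =
      Inl ` {..<a} \<times> Inr ` {..<q} \<union> Inr ` {..<q} \<times> Inl ` {..<a}"
    by (simp add: complete_bipartite_def Let_def)
  show "Inl ` {..<a} \<inter> Inr ` {..<q} = {}" by auto
  show "card (Inl ` {..<a}) = a" "card (Inr ` {..<q}) = q"
    by (simp_all add: card_image)
qed

lemma exists_distinct_representatives:
  assumes "finite V" and "\<And>v. v \<in> V \<Longrightarrow> finite (L v) \<and> card V \<le> card (L v)"
  shows "\<exists>c. inj_on c V \<and> (\<forall>v \<in> V. c v \<in> L v)"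
  using assms
proof (induction V rule: finite_induct)
  case empty
  then show ?case by simp
next
  case (insert x V)
  then have "\<exists>c. inj_on c V \<and> (\<forall>v \<in> V. c v \<in> L v)"
    by (metis card_insert_disjoint insertCI Suc_leD)
  then obtain c where c: "inj_on c V" "\<forall>v \<in> V. c v \<in> L v" by blast
  have "card (c ` V) < card (L x)"
    using insert card_image_le[of V c] by (metis card_insert_disjoint insertI1 Suc_le_eq le_less_trans)
  then have "\<not> L x \<subseteq> c ` V"
    using insert.hyps(1) by (metis card_mono finite_imageI leD)
  then obtain y where y: "y \<in> L x" "y \<notin> c ` V" by blast
  have "(c(x := y)) ` V = c ` V" "inj_on (c(x := y)) V"
    using insert.hyps(2) c(1) by (auto simp: inj_on_def)
  then have "inj_on (c(x := y)) (insert x V)"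
    using insert.hyps(2) y(2) by (simp add: inj_on_insert)
  moreover have "\<forall>v \<in> insert x V. (c(x := y)) v \<in> L v"
    using c(2) y(1) by simp
  ultimately show ?case by blast
qed

text \<open>The minimum is taken over a nonempty set, and is therefore attained.\<close>

lemma sum_choice_number_attained:
  assumes "graph G"
  shows "\<exists>f. choosable G f \<and> sum_choice_number G = (\<Sum>v \<in> verts G. f v)"
proof -
  interpret graph G by fact
  have "choosable G (\<lambda>_. card (verts G))"
    unfolding choosable_def
  proof (intro allI impI)
    fix L assume "list_assignment G (\<lambda>_. card (verts G)) L"
    then obtain c where c: "inj_on c (verts G)" "\<forall>v \<in> verts G. c v \<in> L v"
      using exists_distinct_representatives[of "verts G" L]
      by (auto simp: list_assignment_def)
    have "proper_coloring G c"
      unfolding proper_coloring_def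
      using c(1) no_loops by (metis inj_onD head_in_verts tail_in_verts)
    with c(2) show "\<exists>c. proper_coloring G c \<and> (\<forall>v \<in> verts G. c v \<in> L v)" by blast
  qed
  then have "\<exists>n f. choosable G f \<and> n = (\<Sum>v \<in> verts G. f v)" by blast
  then show ?thesis unfolding sum_choice_number_def by (rule LeastI_ex)
qed

end

theory Submission
  imports Defs
begin

text \<open>
  Upper bound: give lists of size \<open>2\<close> to the large part and lists of size \<open>k \<approx> 12 \<surd>(q ln a)\<close> to the
  small part. Reserve a random set \<open>C\<close> of colors for the small part, each color independently with
  probability \<open>8 ln a / k\<close>. With positive probability fewer than \<open>ln a\<close> of the \<open>2\<close>-lists are
  contained in \<open>C\<close>, while every \<open>k\<close>-list meets \<open>C\<close> in more than \<open>ln a\<close> colors. Removing from \<open>C\<close> one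
  color of each contained \<open>2\<close>-list leaves a usable color in every list.

  Lower bound: let the \<open>2\<close>-lists be the edges of \<open>t\<close> disjoint copies of \<open>K\<^bsub>s,s\<^esub>\<close>, and let \<open>2\<^sup>t\<close>
  vertices of the small part have as lists all unions of one side from each copy, of size \<open>t s\<close>. The
  colors used on the small part avoid one side of every copy, hence avoid one of these lists. If the
  sum of the list sizes were too small, at least half of the large part would have lists of size \<open>2\<close>
  and more than half of the small part would have lists of size at most \<open>\<surd>(q ln a) / 5\<close>, so that this
  obstruction would apply with \<open>t \<ge> ln a / 3\<close> and \<open>t s\<^sup>2\<close> at most the number of
  \<open>2\<close>-lists. Lists of size \<open>1\<close> do not help: each of them can block a color of every list of the
  small part.
\<close>

section \<open>Choosability and sum choice number in terms of the two parts\<close>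

lemma choosable_complete_bipartite_iff:
  "choosable (with_proj (complete_bipartite a q)) f \<longleftrightarrow>
    (\<forall>LA LB :: nat \<Rightarrow> nat set. (\<forall>i<a. finite (LA i) \<and> card (LA i) = f (Inl i)) \<longrightarrow>
       (\<forall>j<q. finite (LB j) \<and> card (LB j) = f (Inr j)) \<longrightarrow>
       (\<exists>cA cB. (\<forall>i<a. cA i \<in> LA i) \<and> (\<forall>j<q. cB j \<in> LB j) \<and>
          (\<forall>i<a. \<forall>j<q. cA i \<noteq> cB j)))" (is "?l \<longleftrightarrow> ?r")
proof
  assume l: ?l
  show ?r
  proof (intro allI impI)
    fix LA LB :: "nat \<Rightarrow> nat set"
    assume A: "\<forall>i<a. finite (LA i) \<and> card (LA i) = f (Inl i)"
      and B: "\<forall>j<q. finite (LB j) \<and> card (LB j) = f (Inr j)"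
    have "list_assignment (with_proj (complete_bipartite a q)) f (case_sum LA LB)"
      using A B by (auto simp: list_assignment_def complete_bipartite_def Let_def)
    with l obtain c where c: "proper_coloring (with_proj (complete_bipartite a q)) c"
      "\<forall>v \<in> verts (with_proj (complete_bipartite a q)). c v \<in> case_sum LA LB v"
      unfolding choosable_def by blast
    show "\<exists>cA cB. (\<forall>i<a. cA i \<in> LA i) \<and> (\<forall>j<q. cB j \<in> LB j) \<and>
          (\<forall>i<a. \<forall>j<q. cA i \<noteq> cB j)"
    proof (rule exI[of _ "c \<circ> Inl"], rule exI[of _ "c \<circ> Inr"])
      show "(\<forall>i<a. (c \<circ> Inl) i \<in> LA i) \<and> (\<forall>j<q. (c \<circ> Inr) j \<in> LB j) \<and>
          (\<forall>i<a. \<forall>j<q. (c \<circ> Inl) i \<noteq> (c \<circ> Inr) j)"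
        using c by (auto simp: proper_coloring_def complete_bipartite_def Let_def ball_Un)
    qed
  qed
next
  assume r: ?r
  show ?l
    unfolding choosable_def
  proof (intro allI impI)
    fix L assume "list_assignment (with_proj (complete_bipartite a q)) f L"
    then have L: "\<forall>i<a. finite ((L \<circ> Inl) i) \<and> card ((L \<circ> Inl) i) = f (Inl i)"
      "\<forall>j<q. finite ((L \<circ> Inr) j) \<and> card ((L \<circ> Inr) j) = f (Inr j)"
      by (auto simp: list_assignment_def complete_bipartite_def Let_def)
    obtain cA cB where c: "\<forall>i<a. cA i \<in> (L \<circ> Inl) i" "\<forall>j<q. cB j \<in> (L \<circ> Inr) j"
      "\<forall>i<a. \<forall>j<q. cA i \<noteq> cB j"
      using r[THEN spec, THEN spec, THEN mp, THEN mp, OF L] by blast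
    show "\<exists>c. proper_coloring (with_proj (complete_bipartite a q)) c \<and>
      (\<forall>v \<in> verts (with_proj (complete_bipartite a q)). c v \<in> L v)"
      using c by (intro exI[of _ "case_sum cA cB"])
        (fastforce simp: proper_coloring_def complete_bipartite_def Let_def)
  qed
qed

lemma choosable_complete_bipartiteE:
  fixes LA LB :: "nat \<Rightarrow> nat set"
  assumes "choosable (with_proj (complete_bipartite a q)) f"
    and "\<And>i. i < a \<Longrightarrow> finite (LA i) \<and> card (LA i) = f (Inl i)"
    and "\<And>j. j < q \<Longrightarrow> finite (LB j) \<and> card (LB j) = f (Inr j)"
  obtains cA cB where "\<And>i. i < a \<Longrightarrow> cA i \<in> LA i" "\<And>j. j < q \<Longrightarrow> cB j \<in> LB j"
    "\<And>i j. i < a \<Longrightarrow> j < q \<Longrightarrow> cA i \<noteq> cB j"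
proof -
  have "\<forall>i<a. finite (LA i) \<and> card (LA i) = f (Inl i)"
    "\<forall>j<q. finite (LB j) \<and> card (LB j) = f (Inr j)"
    using assms(2,3) by blast+
  from assms(1)[unfolded choosable_complete_bipartite_iff,
      THEN spec, THEN spec, THEN mp, THEN mp, OF this]
  show ?thesis using that by blast
qed

lemma sum_verts_complete_bipartite:
  "(\<Sum>v \<in> verts (with_proj (complete_bipartite a q)). f v) =
    (\<Sum>i<a. f (Inl i)) + (\<Sum>j<q. f (Inr j))"
proof -
  have "(\<Sum>v \<in> Inl ` {..<a} \<union> Inr ` {..<q}. f v) = (\<Sum>i<a. f (Inl i)) + (\<Sum>j<q. f (Inr j))"
    by (subst sum.union_disjoint) (auto simp: sum.reindex)
  then show ?thesis by (simp add: complete_bipartite_def Let_def)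
qed

lemma sum_choice_number_le:
  "choosable G f \<Longrightarrow> sum_choice_number G \<le> (\<Sum>v \<in> verts G. f v)"
  unfolding sum_choice_number_def by (rule Least_le) blast

section \<open>Upper bound: random reservation and deletion\<close>

lemma ex_less_one_weighted:
  fixes w \<phi> :: "'a \<Rightarrow> real"
  assumes "finite S" "\<And>x. x \<in> S \<Longrightarrow> w x \<ge> 0" "sum w S = 1" "(\<Sum>x\<in>S. w x * \<phi> x) < 1"
  shows "\<exists>x\<in>S. \<phi> x < 1"
proof (rule ccontr)
  assume "\<not> ?thesis"
  then have "sum w S \<le> (\<Sum>x\<in>S. w x * \<phi> x)"
    using assms(2) by (intro sum_mono) (force simp: mult_le_cancel_left1 not_less)
  with assms show False by simp
qed

text \<open>One expectation controls both requirements: a first moment counts the contained 2-lists,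
  and an exponential moment penalises every k-list that meets \<open>C\<close> in few
  colors.\<close>

lemma ex_color_set:
  fixes LA LB :: "nat \<Rightarrow> nat set" and a q k :: nat
  assumes a: "a \<ge> 2" and q: "real q \<ge> ln (real a)"
    and k: "real k \<ge> 12 * sqrt (real q * ln (real a))"
    and LA: "\<And>i. i < a \<Longrightarrow> finite (LA i) \<and> card (LA i) = k"
    and LB: "\<And>j. j < q \<Longrightarrow> finite (LB j) \<and> card (LB j) = 2"
  shows "\<exists>C. finite C \<and> real (card {j. j < q \<and> LB j \<subseteq> C}) < ln (real a) \<and>
    (\<forall>i<a. ln (real a) < real (card (LA i \<inter> C)))"
proof -
  define T where "T = ln (real a)"
  have T: "T > 0" using a by (simp add: T_def)
  have expT: "exp T = real a" using a by (simp add: T_def)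
  have qpos: "real q > 0" using q T by (simp add: T_def)
  \<comment> \<open>This yields \<open>k >= 12 * T\<close>, so that \<open>p\<close> below is a
    probability.\<close>
  have sqT: "sqrt (real q * T) \<ge> T"
  proof -
    have "T * T \<le> real q * T" using q T by (intro mult_right_mono) (auto simp: T_def)
    then show ?thesis using T by (intro real_le_rsqrt) (simp add: power2_eq_square)
  qed
  have kT: "real k \<ge> 12 * T" using k sqT by (simp add: T_def)
  then have kpos: "real k > 0" using T by linarith
  have k2: "(real k)\<^sup>2 \<ge> 144 * (real q * T)"
  proof -
    have "(12 * sqrt (real q * T))\<^sup>2 \<le> (real k)\<^sup>2"
      using k T by (intro power_mono) (auto simp: T_def)
    then show ?thesis using T by (simp add: power_mult_distrib)
  qed
  \<comment> \<open>The 8 brings \<open>(1 - p/2) ^ k\<close> down to \<open>exp (- 4 * T)\<close>,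
    which beats the factor \<open>a * exp T = exp (2 * T)\<close>. The 12 in the bound on
    \<open>k\<close> then keeps \<open>q * p^2 / T\<close> at most 64/144.\<close>
  define p where "p = 8 * T / real k"
  have p: "0 < p" "p \<le> 1" using T kT kpos by (auto simp: p_def field_simps)
  define U where "U = (\<Union>i<a. LA i) \<union> (\<Union>j<q. LB j)"
  have U: "finite U" using LA LB by (auto simp: U_def)
  \<comment> \<open>The product distribution on \<open>Pow U\<close>; \<open>prod_add\<close> turns
    its expectations into products over single colors.\<close>
  define w where "w C = (\<Prod>x\<in>C. p) * (\<Prod>x\<in>U - C. 1 - p)" for C
  have w0: "w C \<ge> 0" for C
    using p by (simp add: w_def prod_nonneg)
  have w1: "sum w (Pow U) = 1"
    unfolding w_def by (subst prod_add[OF U, symmetric]) simp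
  have wsub: "(\<Sum>C\<in>Pow U. w C * of_bool (S \<subseteq> C)) = p ^ card S" if S: "S \<subseteq> U" for S
  proof -
    \<comment> \<open>Zeroing the factor of each color of \<open>S\<close> left out of
      \<open>C\<close> encodes the event \<open>S \<subseteq> C\<close> and keeps the product
      form.\<close>
    have "w C * of_bool (S \<subseteq> C) = (\<Prod>x\<in>C. p) * (\<Prod>x\<in>U - C. if x \<in> S then 0 else 1 - p)"
      if "C \<in> Pow U" for C
    proof (cases "S \<subseteq> C")
      case True
      then have "(\<Prod>x\<in>U - C. if x \<in> S then 0 else 1 - p) = (\<Prod>x\<in>U - C. 1 - p)"
        by (intro prod.cong) auto
      with True show ?thesis by (simp add: w_def)
    next
      case False
      then obtain x where "x \<in> S" "x \<notin> C" by auto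
      then have "(\<Prod>x\<in>U - C. if x \<in> S then 0 else 1 - p) = 0"
        using S U by (intro prod_zero) auto
      with False show ?thesis by simp
    qed
    then have "(\<Sum>C\<in>Pow U. w C * of_bool (S \<subseteq> C))
        = (\<Prod>x\<in>U. p + (if x \<in> S then 0 else 1 - p))"
      by (simp add: prod_add[OF U])
    also have "\<dots> = (\<Prod>x\<in>U. if x \<in> S then p else 1)"
      by (intro prod.cong) auto
    also have "\<dots> = p ^ card S"
      using U S by (simp add: prod.If_cases Int_absorb1 flip: Int_def)
    finally show ?thesis .
  qed
  have whalf: "(\<Sum>C\<in>Pow U. w C * (1/2) ^ card (S \<inter> C)) = (1 - p/2) ^ card S" if S: "S \<subseteq> U" for S
  proof -
    \<comment> \<open>Each chosen color of \<open>S\<close> absorbs one factor 1/2, so this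
      expectation factors as well.\<close>
    have "w C * (1/2) ^ card (S \<inter> C) = (\<Prod>x\<in>C. if x \<in> S then p/2 else p) * (\<Prod>x\<in>U - C. 1 - p)"
      if "C \<in> Pow U" for C
    proof -
      have C: "finite C" using that U by (auto intro: finite_subset)
      have "(\<Prod>x\<in>C. if x \<in> S then p/2 else p) = (\<Prod>x\<in>C. p * (if x \<in> S then 1/2 else 1))"
        by (intro prod.cong) auto
      also have "\<dots> = (\<Prod>x\<in>C. p) * (1/2) ^ card (S \<inter> C)"
        unfolding prod.distrib using C by (simp add: prod.If_cases Int_commute)
      finally show ?thesis by (simp add: w_def)
    qed
    then have "(\<Sum>C\<in>Pow U. w C * (1/2) ^ card (S \<inter> C))
        = (\<Prod>x\<in>U. (if x \<in> S then p/2 else p) + (1 - p))"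
      by (simp add: prod_add[OF U])
    also have "\<dots> = (\<Prod>x\<in>U. if x \<in> S then 1 - p/2 else 1)"
      by (intro prod.cong) auto
    also have "\<dots> = (1 - p/2) ^ card S"
      using U S by (simp add: prod.If_cases Int_absorb1 flip: Int_def)
    finally show ?thesis .
  qed
  \<comment> \<open>\<open>\<phi> C < 1\<close> forces both required properties of \<open>C\<close>; its expectation under \<open>w\<close> is below \<open>1\<close>.\<close>
  define \<phi> where "\<phi> C = (\<Sum>j<q. of_bool (LB j \<subseteq> C)) / T +
    (\<Sum>i<a. exp T * (1/2) ^ card (LA i \<inter> C))" for C
  have "(\<Sum>C\<in>Pow U. w C * \<phi> C) =
      (\<Sum>j<q. (\<Sum>C\<in>Pow U. w C * of_bool (LB j \<subseteq> C))) / T +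
      (\<Sum>i<a. exp T * (\<Sum>C\<in>Pow U. w C * (1/2) ^ card (LA i \<inter> C)))"
  proof -
    have "(\<Sum>C\<in>Pow U. w C * \<phi> C) =
      (\<Sum>C\<in>Pow U. (\<Sum>j<q. w C * of_bool (LB j \<subseteq> C) / T)) +
      (\<Sum>C\<in>Pow U. (\<Sum>i<a. exp T * (w C * (1/2) ^ card (LA i \<inter> C))))"
      by (simp add: \<phi>_def distrib_left sum.distrib sum_distrib_left sum_divide_distrib mult.left_commute
          del: sum_of_bool_eq)
    then show ?thesis
      by (simp only: sum.swap[where A = "Pow U"] sum_distrib_left sum_divide_distrib)
  qed
  also have "\<dots> = (\<Sum>j<q. p\<^sup>2) / T + (\<Sum>i<a. exp T * (1 - p/2) ^ k)"
    using LA LB by (intro arg_cong2[where f = "(+)"] arg_cong2[where f = "(/)"] sum.cong refl)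
      (subst wsub whalf; force simp: U_def)+
  also have "\<dots> = real q * p\<^sup>2 / T + real a * exp T * (1 - p/2) ^ k" by simp
  also have "\<dots> \<le> 64/144 + 1/4"
  proof (rule add_mono)
    have "real q * p\<^sup>2 / T = 64 * (real q * T) / (real k)\<^sup>2"
      using T kpos by (simp add: p_def power2_eq_square field_simps)
    also have "\<dots> \<le> 64/144"
      using k2 kpos by (simp add: field_simps)
    finally show "real q * p\<^sup>2 / T \<le> 64/144" .
    have "1 - p/2 \<le> exp (- p/2)" using exp_ge_add_one_self[of "- p/2"] by simp
    then have "(1 - p/2) ^ k \<le> exp (- p/2) ^ k"
      using p by (intro power_mono) auto
    also have "\<dots> = exp (- (4 * T))"
      using kpos by (simp add: p_def flip: exp_of_nat_mult)
    finally have "real a * exp T * (1 - p/2) ^ k \<le> exp T * exp T * exp (- (4 * T))"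
      unfolding expT[symmetric] by (intro mult_left_mono) auto
    also have "\<dots> = inverse (exp T * exp T)"
      by (simp flip: exp_add exp_minus)
    also have "\<dots> \<le> inverse (2 * 2)"
      unfolding expT using a by (intro le_imp_inverse_le mult_mono) auto
    finally show "real a * exp T * (1 - p/2) ^ k \<le> 1/4" by simp
  qed
  also have "\<dots> < 1" by simp
  finally have "(\<Sum>C\<in>Pow U. w C * \<phi> C) < 1" .
  then obtain C where C: "C \<subseteq> U" "\<phi> C < 1"
    using ex_less_one_weighted[of "Pow U" w \<phi>] U w0 w1 by auto
  have nn: "(\<Sum>j<q. of_bool (LB j \<subseteq> C) :: real) / T \<ge> 0"
      "(\<Sum>i<a. exp T * (1/2) ^ card (LA i \<inter> C)) \<ge> 0"
    using T by (auto intro!: sum_nonneg divide_nonneg_pos)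
  have "(\<Sum>j<q. of_bool (LB j \<subseteq> C)) / T < 1" using C nn by (simp add: \<phi>_def)
  then have "real (card {j. j < q \<and> LB j \<subseteq> C}) < T"
    using T by (simp add: sum.If_cases of_bool_def Int_def)
  \<comment> \<open>A single summand of \<open>\<phi>\<close> is already below 1, hence
    \<open>exp T < 2 ^ m\<close> for the size m of the intersection, and \<open>2 <= exp 1\<close>
    gives \<open>T < m\<close>.\<close>
  moreover have "T < real (card (LA i \<inter> C))" if i: "i < a" for i
  proof -
    have "exp T * (1/2) ^ card (LA i \<inter> C) \<le> (\<Sum>i<a. exp T * (1/2) ^ card (LA i \<inter> C))"
      using i by (intro member_le_sum) auto
    also have "\<dots> < 1" using C nn by (simp add: \<phi>_def)
    finally have "exp T < 2 ^ card (LA i \<inter> C)" by (simp add: field_simps)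
    also have "\<dots> \<le> exp 1 ^ card (LA i \<inter> C)"
      using exp_ge_add_one_self[of 1] by (intro power_mono) auto
    also have "\<dots> = exp (real (card (LA i \<inter> C)))" by (simp flip: exp_of_nat_mult)
    finally show ?thesis by simp
  qed
  ultimately show ?thesis using C U unfolding T_def by (blast intro: finite_subset)
qed

text \<open>The small part is colored from \<open>D\<close> and the large part from outside
  \<open>D\<close>, so conflicts cannot occur. Deletion removes fewer than \<open>ln a\<close>
  colors from \<open>C\<close>, too few to exhaust a k-list.\<close>

lemma choosable_complete_bipartite_of_large_lists:
  fixes a q k :: nat
  assumes a: "a \<ge> 2" and q: "real q \<ge> ln (real a)"
    and k: "real k \<ge> 12 * sqrt (real q * ln (real a))"
  shows "choosable (with_proj (complete_bipartite a q)) (case_sum (\<lambda>_. k) (\<lambda>_. 2))"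
  unfolding choosable_complete_bipartite_iff
proof (intro allI impI)
  fix LA LB :: "nat \<Rightarrow> nat set"
  assume "\<forall>i<a. finite (LA i) \<and> card (LA i) = case_sum (\<lambda>_. k) (\<lambda>_. 2) (Inl i)"
    and "\<forall>j<q. finite (LB j) \<and> card (LB j) = case_sum (\<lambda>_. k) (\<lambda>_. 2) (Inr j)"
  then have LA: "\<And>i. i < a \<Longrightarrow> finite (LA i) \<and> card (LA i) = k"
    and LB: "\<And>j. j < q \<Longrightarrow> finite (LB j) \<and> card (LB j) = 2" by auto
  obtain C where C: "finite C" "real (card {j. j < q \<and> LB j \<subseteq> C}) < ln (real a)"
    "\<forall>i<a. ln (real a) < real (card (LA i \<inter> C))"
    using ex_color_set[of a q k LA LB] a q k LA LB by blast
  define J where "J = {j. j < q \<and> LB j \<subseteq> C}"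
  define r where "r j = (SOME x. x \<in> LB j)" for j
  have r: "r j \<in> LB j" if "j < q" for j
    using LB[OF that] unfolding r_def by (metis card.empty some_in_eq zero_neq_numeral)
  define D where "D = C - r ` J"
  have "LA i \<inter> D \<noteq> {}" if i: "i < a" for i
  proof
    assume "LA i \<inter> D = {}"
    then have "LA i \<inter> C \<subseteq> r ` J" by (auto simp: D_def)
    then have "card (LA i \<inter> C) \<le> card (r ` J)" by (intro card_mono) (auto simp: J_def)
    also have "\<dots> \<le> card J" by (intro card_image_le) (simp add: J_def)
    finally show False using C(2,3) i unfolding J_def by force
  qed
  then have "\<forall>i<a. \<exists>x. x \<in> LA i \<inter> D" by blast
  then obtain cA where cA: "\<forall>i<a. cA i \<in> LA i \<inter> D" by metis
  have "\<exists>x. x \<in> LB j - D" if "j < q" for j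
    using r[OF that] that by (auto simp: D_def J_def)
  then obtain cB where cB: "\<forall>j<q. cB j \<in> LB j - D" by metis
  show "\<exists>cA cB. (\<forall>i<a. cA i \<in> LA i) \<and> (\<forall>j<q. cB j \<in> LB j) \<and>
          (\<forall>i<a. \<forall>j<q. cA i \<noteq> cB j)"
    by (rule exI[of _ cA], rule exI[of _ cB]) (use cA cB in fastforce)
qed

section \<open>Obstructions to choosability\<close>

lemma ex_surj_on_of_card_le:
  assumes "finite A" "finite B" "card B \<le> card A"
  shows "\<exists>h. B \<subseteq> h ` A"
proof -
  obtain g where g: "inj_on g B" "g ` B \<subseteq> A"
    using assms inj_on_iff_card_le[of B A] by auto
  have "B = inv_into B g ` (g ` B)"
    using g(1) by simp
  then show ?thesis using g(2) by blast
qed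

lemma not_choosable_complete_bipartite:
  assumes W: "W \<subseteq> {..<a}" "2 ^ t \<le> card W" "\<And>i. i \<in> W \<Longrightarrow> f (Inl i) \<le> t * s"
    and B: "B \<subseteq> {..<q}" "t * (s * s) \<le> card B" "\<And>j. j \<in> B \<Longrightarrow> f (Inr j) = 2"
  shows "\<not> choosable (with_proj (complete_bipartite a q)) f"
proof
  assume ch: "choosable (with_proj (complete_bipartite a q)) f"
  \<comment> \<open>A color codes a triple: copy of the bipartite graph, side, position on that
    side.\<close>
  define col :: "nat \<times> bool \<times> nat \<Rightarrow> nat" where "col = to_nat"
  have col: "col u = col v \<longleftrightarrow> u = v" for u v by (simp add: col_def)
  have fin: "finite W" "finite B" using W(1) B(1) by (auto intro: finite_subset)
  \<comment> \<open>Surjections suffice: every choice of sides and every edge must occur as a list,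
    repetitions being harmless.\<close>
  obtain h where h: "Pow {..<t} \<subseteq> h ` W"
    using ex_surj_on_of_card_le[of W "Pow {..<t}"] fin W(2) by (auto simp: card_Pow)
  obtain g where g: "{..<t} \<times> {..<s} \<times> {..<s} \<subseteq> g ` B"
    using ex_surj_on_of_card_le[of B "{..<t} \<times> {..<s} \<times> {..<s}"] fin B(2)
    by (auto simp: card_cartesian_product)
  define side where "side X = (\<lambda>(i, x). col (i, i \<in> X, x)) ` ({..<t} \<times> {..<s})" for X
  have card_side: "card (side X) = t * s" for X
    unfolding side_def by (subst card_image) (auto simp: inj_on_def col card_cartesian_product)
  \<comment> \<open>Lists shorter than \<open>t * s\<close> are cut out of
    \<open>side (h i)\<close>; only this containment matters later.\<close>
  have "\<exists>S. finite S \<and> card S = f (Inl i) \<and> (i \<in> W \<longrightarrow> S \<subseteq> side (h i))" for i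
  proof (cases "i \<in> W")
    case True
    then have "f (Inl i) \<le> card (side (h i))" using W(3) card_side by simp
    then show ?thesis by (meson obtain_subset_with_card_n)
  next
    case False
    then show ?thesis by (intro exI[of _ "{..<f (Inl i)}"]) simp
  qed
  then obtain LA where LA: "\<And>i. finite (LA i) \<and> card (LA i) = f (Inl i)"
    "\<And>i. i \<in> W \<Longrightarrow> LA i \<subseteq> side (h i)" by metis
  define LB where "LB j = (if j \<in> B
    then (case g j of (i, x, y) \<Rightarrow> {col (i, False, x), col (i, True, y)})
    else {..<f (Inr j)})" for j
  have LB: "finite (LB j) \<and> card (LB j) = f (Inr j)" for j
    using B(3) by (auto simp: LB_def col split: prod.split)
  obtain cA cB where cA: "\<And>i. i < a \<Longrightarrow> cA i \<in> LA i" and cB: "\<And>j. j < q \<Longrightarrow> cB j \<in> LB j"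
    and ne: "\<And>i j. i < a \<Longrightarrow> j < q \<Longrightarrow> cA i \<noteq> cB j"
    using choosable_complete_bipartiteE[OF ch, of LA LB] LA(1) LB by blast
  \<comment> \<open>Two such colors form the whole list of some vertex of \<open>B\<close>, which
    would have no color left.\<close>
  have one_side: False
    if "i < t" "x < s" "y < s" "u < a" "v < a" "cA u = col (i, False, x)" "cA v = col (i, True, y)"
    for i x y u v
  proof -
    have "(i, x, y) \<in> g ` B" using g that by blast
    then obtain j where j: "j \<in> B" "g j = (i, x, y)" by auto
    then have "cB j \<in> {col (i, False, x), col (i, True, y)}" "j < q"
      using cB[of j] B(1) by (auto simp: LB_def)
    with ne that show False by (metis insertE singletonD)
  qed
  define X where "X = {i. i < t \<and> \<not> (\<exists>x<s. \<exists>v<a. cA v = col (i, True, x))}"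
  have "X \<in> h ` W" using h by (auto simp: X_def)
  then obtain u where u: "u \<in> W" "h u = X" by auto
  then have ua: "u < a" using W(1) by auto
  have "cA u \<in> side X" using cA[OF ua] LA(2)[OF u(1)] u(2) by auto
  then obtain i x where ix: "i < t" "x < s" "cA u = col (i, i \<in> X, x)"
    by (auto simp: side_def)
  show False
  proof (cases "i \<in> X")
    case True
    then show False using ix ua by (auto simp: X_def)
  next
    case False
    then obtain y v where "y < s" "v < a" "cA v = col (i, True, y)"
      using ix(1) by (auto simp: X_def)
    with one_side[of i x y u v] False ix ua show False by simp
  qed
qed

lemma choosable_complete_bipartite_pos:
  assumes ch: "choosable (with_proj (complete_bipartite a q)) f" and j: "j < q"
  shows "f (Inr j) > 0"
proof -
  obtain cB where "\<And>j. j < q \<Longrightarrow> cB j \<in> {..<f (Inr j)}"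
    by (rule choosable_complete_bipartiteE[OF ch, of "\<lambda>i. {..<f (Inl i)}" "\<lambda>j. {..<f (Inr j)}"]) auto
  from this[OF j] show ?thesis by simp
qed

text \<open>Otherwise the list of \<open>i\<close> can consist of forced colors: the vertex
  \<open>j\<close> with a list of size 1 receives \<open>{j}\<close>, and the list of
  \<open>i\<close> is drawn from these \<open>j\<close>.\<close>

lemma choosable_complete_bipartite_card_singletons_le:
  assumes ch: "choosable (with_proj (complete_bipartite a q)) f" and i: "i < a"
  shows "card {j. j < q \<and> f (Inr j) = 1} \<le> f (Inl i)"
proof (rule ccontr)
  define J where "J = {j. j < q \<and> f (Inr j) = 1}"
  assume "\<not> ?thesis"
  then have "f (Inl i) \<le> card J" by (simp add: J_def)
  then obtain S where S: "S \<subseteq> J" "card S = f (Inl i)" "finite S"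
    by (meson obtain_subset_with_card_n)
  define LA where "LA u = (if u = i then S else {..<f (Inl u)})" for u
  define LB where "LB j = (if f (Inr j) = 1 then {j} else {..<f (Inr j)})" for j
  have "finite (LA u) \<and> card (LA u) = f (Inl u)" "finite (LB j) \<and> card (LB j) = f (Inr j)" for u j
    using S by (auto simp: LA_def LB_def)
  then obtain cA cB where c: "\<And>i. i < a \<Longrightarrow> cA i \<in> LA i" "\<And>j. j < q \<Longrightarrow> cB j \<in> LB j"
    "\<And>i j. i < a \<Longrightarrow> j < q \<Longrightarrow> cA i \<noteq> cB j"
    using choosable_complete_bipartiteE[OF ch, of LA LB] by blast
  have "cA i \<in> J" using c(1)[OF i] S(1) by (auto simp: LA_def)
  then have "cA i < q" "cB (cA i) = cA i" using c(2)[of "cA i"] by (auto simp: J_def LB_def)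
  with c(3)[OF i] show False by metis
qed

section \<open>Lower bound: counting list sizes\<close>

lemma real_card_eq_sum_of_bool: "real (card {j. j < q \<and> P j}) = (\<Sum>j<q. of_bool (P j))" for q :: nat
  by (simp add: sum.If_cases of_bool_def Int_def)

lemma half_le_ln: "2 \<le> x \<Longrightarrow> 1 / 2 \<le> ln x" for x :: real
proof -
  assume x: "2 \<le> x"
  have "ln (1 / x) \<le> 1 / x - 1" using x by (intro ln_le_minus_one) simp
  moreover have "1 / x \<le> 1 / 2" using x by (intro divide_left_mono) auto
  moreover have "ln (1 / x) = - ln x" using x by (simp add: ln_div)
  ultimately show ?thesis by linarith
qed

text \<open>Only lists of size 1 save on \<open>2 * q\<close>, one unit each, but they force
  \<open>S >= a * card J1 >= 2 * card J1\<close>. The saving is thus at most half of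
  \<open>S\<close>.\<close>

lemma choosable_complete_bipartite_sum_ge:
  fixes a q :: nat
  assumes a: "a \<ge> 2" and q: "real q \<ge> 4 * (real a)\<^sup>2 * ln (real a)"
    and ch: "choosable (with_proj (complete_bipartite a q)) f"
  shows "2 * real q + 1/20 * real a * sqrt (real q * ln (real a))
    \<le> (\<Sum>i<a. real (f (Inl i))) + (\<Sum>j<q. real (f (Inr j)))"
proof (rule ccontr)
  assume less: "\<not> ?thesis"
  define Q where "Q = sqrt (real q * ln (real a))"
  define S where "S = (\<Sum>i<a. real (f (Inl i)))"
  define J1 where "J1 = {j. j < q \<and> f (Inr j) = 1}"
  define J2 where "J2 = {j. j < q \<and> f (Inr j) = 2}"
  define J3 where "J3 = {j. j < q \<and> f (Inr j) \<ge> 3}"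
  have ln_a: "ln (real a) \<ge> 1/2" using half_le_ln a by simp
  have qa: "real q \<ge> 2 * (real a)\<^sup>2"
  proof -
    have "4 * (real a)\<^sup>2 * (1/2) \<le> 4 * (real a)\<^sup>2 * ln (real a)"
      using ln_a by (intro mult_left_mono) auto
    with q show ?thesis by linarith
  qed
  have "(real a)\<^sup>2 > 0" using a by simp
  with qa have q0: "real q > 0" by linarith
  have Q: "Q > 0" "Q\<^sup>2 = real q * ln (real a)"
    using q0 ln_a by (auto simp: Q_def)
  \<comment> \<open>The hypothesis on \<open>q\<close> in square-root form; it makes the error term
    small compared with \<open>q\<close>.\<close>
  have aQ: "real a * Q \<le> real q / 2"
  proof (rule power2_le_imp_le)
    have "(real a * Q)\<^sup>2 = real q * ((real a)\<^sup>2 * ln (real a))"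
      by (simp add: power_mult_distrib Q)
    also have "\<dots> \<le> real q * (real q / 4)" using q by (intro mult_left_mono) auto
    finally show "(real a * Q)\<^sup>2 \<le> (real q / 2)\<^sup>2" by (simp add: power2_eq_square)
  qed simp
  have pos: "f (Inr j) > 0" if "j < q" for j
    using choosable_complete_bipartite_pos[OF ch that] .
  have "(\<Sum>j<q. real (f (Inr j)) + of_bool (f (Inr j) = 1)) \<ge> (\<Sum>j<q. 2 + of_bool (f (Inr j) \<ge> 3))"
    using pos by (intro sum_mono) (force simp: of_bool_def)
  then have sumB: "(\<Sum>j<q. real (f (Inr j))) + real (card J1) \<ge> 2 * real q + real (card J3)"
    by (simp add: sum.distrib J1_def J3_def real_card_eq_sum_of_bool)
  have "(\<Sum>j<q. of_bool (f (Inr j) = 1) + of_bool (f (Inr j) = 2) + of_bool (f (Inr j) \<ge> 3))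
      = (\<Sum>j<q. 1 :: real)"
    using pos by (intro sum.cong) (force simp: of_bool_def)+
  then have cards: "real (card J1) + real (card J2) + real (card J3) = real q"
    by (simp add: sum.distrib J1_def J2_def J3_def real_card_eq_sum_of_bool)
  have "real a * real (card J1) \<le> S"
    using sum_mono[of "{..<a}" "\<lambda>_. real (card J1)" "\<lambda>i. real (f (Inl i))"]
      choosable_complete_bipartite_card_singletons_le[OF ch]
    by (simp add: S_def J1_def)
  moreover have "2 * real (card J1) \<le> real a * real (card J1)"
    using a by (intro mult_right_mono) auto
  ultimately have J1: "2 * real (card J1) \<le> S" by linarith
  have tot: "S + (\<Sum>j<q. real (f (Inr j))) < 2 * real q + 1/20 * (real a * Q)"
    using less by (simp add: S_def Q_def)
  have S: "S < 1/10 * (real a * Q)" using tot sumB J1 by linarith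
  have S0: "S \<ge> 0" by (simp add: S_def sum_nonneg)
  \<comment> \<open>In fact \<open>card J1 + card J3 < a * Q / 20 <= q / 40\<close>.\<close>
  have J2: "real (card J2) \<ge> real q / 2" using tot sumB J1 cards aQ S0 by linarith

  \<comment> \<open>The threshold is twice the bound \<open>Q / 10\<close> on the average, so by
    Markov more than half of the small part lies in \<open>W\<close>.\<close>
  define W where "W = {i. i < a \<and> real (f (Inl i)) \<le> Q / 5}"
  have W: "real a < 2 * real (card W)"
  proof -
    have "real a * (Q/5) \<le> (\<Sum>i<a. real (f (Inl i)) + Q/5 * of_bool (real (f (Inl i)) \<le> Q/5))"
      using sum_mono[of "{..<a}" "\<lambda>_. Q/5" "\<lambda>i. real (f (Inl i)) + Q/5 * of_bool (real (f (Inl i)) \<le> Q/5)"]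
      by simp
    also have "\<dots> = S + Q/5 * real (card W)"
      by (simp only: sum.distrib S_def W_def real_card_eq_sum_of_bool sum_distrib_left)
    finally have "real a * (Q/5) < 1/10 * (real a * Q) + Q/5 * real (card W)" using S by linarith
    then have "Q * real a < Q * (2 * real (card W))" by (simp add: field_simps)
    then show ?thesis using Q(1) by simp
  qed

  obtain n where n: "2 ^ n \<le> a" "a < 2 ^ (n + 1)"
    using ex_power_ivl1[of 2 a] a by auto
  have n1: "n \<ge> 1" using n(2) a by (cases n) auto
  \<comment> \<open>Since \<open>card W > a / 2\<close>, the exponent \<open>n - 1\<close> is safe;
    for \<open>n = 1\<close> the exponent 1 still works because \<open>card W >= 2\<close>.\<close>
  define t where "t = max 1 (n - 1)"
  have t: "2 ^ t \<le> card W"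
  proof (cases "n = 1")
    case True
    then show ?thesis using W a by (simp add: t_def)
  next
    case False
    then have "n = Suc t" using n1 by (simp add: t_def)
    then have "2 * 2 ^ t \<le> a" using n(1) by simp
    moreover have "a < 2 * card W" using W by linarith
    ultimately show ?thesis by linarith
  qed
  have t1: "t \<ge> 1" by (simp add: t_def)
  have lnt: "ln (real a) \<le> 3 * real t"
  proof -
    have "real a \<le> 2 ^ (n + 1)" using n(2) by (metis of_nat_le_iff of_nat_numeral of_nat_power less_imp_le)
    also have "\<dots> \<le> exp 1 ^ (n + 1)" using exp_ge_add_one_self[of 1] by (intro power_mono) auto
    also have "\<dots> = exp (real (n + 1))" by (metis exp_of_nat_mult mult.right_neutral)
    finally have "ln (real a) \<le> ln (exp (real (n + 1)))"
      using a by (subst ln_le_cancel_iff) auto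
    then have "ln (real a) \<le> real (n + 1)" by simp
    \<comment> \<open>Equality occurs at \<open>n = 2\<close>, \<open>t = 1\<close>, which explains
      the factor 3.\<close>
    also have "\<dots> \<le> 3 * real t" using n1 by (auto simp: t_def)
    finally show ?thesis .
  qed
  have "t \<le> n" using n1 by (simp add: t_def)
  also have "n \<le> a" using n(1) less_exp[of n] by linarith
  finally have "real t \<le> real a" by simp
  also have "\<dots> \<le> (real a)\<^sup>2" using a by (simp add: power2_eq_square)
  finally have tJ2: "real t \<le> real (card J2)" using qa J2 by linarith

  define x where "x = sqrt (real (card J2) / real t)"
  \<comment> \<open>The largest side length with \<open>t * s^2 <= card J2\<close>; as
    \<open>x >= 1\<close>, rounding down loses at most a factor 2.\<close>
  define s where "s = nat \<lfloor>x\<rfloor>"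
  have x1: "x \<ge> 1" using tJ2 t1 by (simp add: x_def)
  have x2: "real t * x\<^sup>2 = real (card J2)" using t1 by (simp add: x_def)
  have "\<lfloor>x\<rfloor> \<ge> 1" using x1 by simp
  then have s: "real s \<le> x" "x / 2 \<le> real s"
    unfolding s_def by linarith+
  have "real t * (real s)\<^sup>2 \<le> real t * x\<^sup>2" using s(1) by (intro mult_left_mono power_mono) auto
  then have "real (t * (s * s)) \<le> real (card J2)"
    unfolding x2 by (simp add: power2_eq_square)
  then have ts: "t * (s * s) \<le> card J2"
    by (simp only: of_nat_le_iff)
  \<comment> \<open>From \<open>q <= 2 * card J2\<close> and \<open>ln a <= 3 * t\<close> the square
    is at most 6/25 of \<open>t * card J2\<close>, just below the 1/4 left by the rounding.\<close>
  have Qts: "Q / 5 \<le> real (t * s)"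
  proof (rule power2_le_imp_le)
    have "(Q/5)\<^sup>2 = real q * ln (real a) / 25" by (simp add: power_divide Q)
    also have "\<dots> \<le> (2 * real (card J2)) * (3 * real t) / 25"
      using J2 lnt ln_a by (intro divide_right_mono mult_mono) auto
    also have "\<dots> \<le> real t * real (card J2) / 4" by simp
    also have "\<dots> = (real t * (x / 2))\<^sup>2"
      unfolding x2[symmetric] by (simp add: power2_eq_square)
    also have "\<dots> \<le> (real (t * s))\<^sup>2"
      unfolding of_nat_mult using s x1 by (intro power_mono mult_left_mono) auto
    finally show "(Q/5)\<^sup>2 \<le> (real (t * s))\<^sup>2" .
  qed simp
  have "f (Inl i) \<le> t * s" if "i \<in> W" for i
  proof -
    have "real (f (Inl i)) \<le> real (t * s)" using that Qts by (simp add: W_def)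
    then show ?thesis by (simp only: of_nat_le_iff)
  qed
  then have "\<not> choosable (with_proj (complete_bipartite a q)) f"
    using t ts by (intro not_choosable_complete_bipartite[of W a t f s J2 q]) (auto simp: W_def J2_def)
  with ch show False by contradiction
qed

section \<open>Combining the two bounds\<close>

theorem theorem2p1:
  shows "\<exists>c1 c2 :: real. c1 > 0 \<and> c2 > 0 \<and>
    (\<forall>a q :: nat. a \<ge> 2 \<longrightarrow> real q \<ge> 4 * (real a)\<^sup>2 * ln (real a) \<longrightarrow>
      2 * real q + c1 * real a * sqrt (real q * ln (real a))
        \<le> real (sum_choice_number (with_proj (complete_bipartite a q))) \<and>
      real (sum_choice_number (with_proj (complete_bipartite a q)))
        \<le> 2 * real q + c2 * real a * sqrt (real q * ln (real a)))"
proof (rule exI[of _ "1/20"], rule exI[of _ 13], intro conjI allI impI)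
  fix a q :: nat
  assume a: "a \<ge> 2" and q: "real q \<ge> 4 * (real a)\<^sup>2 * ln (real a)"
  define G where "G = with_proj (complete_bipartite a q)"
  define k where "k = nat \<lceil>12 * sqrt (real q * ln (real a))\<rceil>"
  have ln_a: "ln (real a) \<ge> 1/2" using half_le_ln a by simp
  have "4 * (2 * 2) * ln (real a) \<le> 4 * (real a)\<^sup>2 * ln (real a)"
    using a ln_a unfolding power2_eq_square by (intro mult_right_mono mult_left_mono mult_mono) auto
  with q have q16: "real q \<ge> 16 * ln (real a)" by linarith
  have k: "real k \<ge> 12 * sqrt (real q * ln (real a))" unfolding k_def by linarith
  have ch: "choosable G (case_sum (\<lambda>_. k) (\<lambda>_. 2))"
    unfolding G_def using a q16 ln_a k by (intro choosable_complete_bipartite_of_large_lists) auto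
  \<comment> \<open>The square root is at least 1, so rounding up in \<open>k\<close> is absorbed by
    passing from 12 to 13.\<close>
  have "8 * (1/2) \<le> real q * ln (real a)"
    using q16 ln_a by (intro mult_mono) auto
  then have "sqrt (real q * ln (real a)) \<ge> 1" by simp
  then have "real k \<le> 13 * sqrt (real q * ln (real a))" unfolding k_def by linarith
  then have "real a * real k \<le> real a * (13 * sqrt (real q * ln (real a)))"
    by (intro mult_left_mono) auto
  moreover have "sum_choice_number G \<le> a * k + 2 * q"
    using sum_choice_number_le[OF ch] unfolding G_def sum_verts_complete_bipartite by simp
  then have "real (sum_choice_number G) \<le> real (a * k + 2 * q)"
    by (simp only: of_nat_le_iff)
  ultimately show "real (sum_choice_number (with_proj (complete_bipartite a q)))
        \<le> 2 * real q + 13 * real a * sqrt (real q * ln (real a))"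
    by (simp add: G_def mult_ac)
  have "\<exists>n f. choosable G f \<and> n = (\<Sum>v \<in> verts G. f v)" using ch by auto
  then have "\<exists>f. choosable G f \<and> sum_choice_number G = (\<Sum>v \<in> verts G. f v)"
    unfolding sum_choice_number_def by (rule LeastI_ex)
  then obtain f where f: "choosable G f" "sum_choice_number G = (\<Sum>v \<in> verts G. f v)"
    by blast
  show "2 * real q + 1/20 * real a * sqrt (real q * ln (real a))
        \<le> real (sum_choice_number (with_proj (complete_bipartite a q)))"
    using choosable_complete_bipartite_sum_ge[OF a q f(1)[unfolded G_def]] f(2)
    unfolding G_def sum_verts_complete_bipartite by simp
qed simp_all

end
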